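(* Let $\{X_i\}_{i=1}^{\infty}$ be a convolutionary sequence of identically distributed $d$-dimensional random vectors on a sublinear expectation space $(\Omega,\mathcal{H},\mathbb{E})$ with $\mathbb{E}[|X_1|^2]<\infty$, and let $S_n=\sum_{i=1}^{n}X_i$. Let $\eta$ be a $d$-dimensional random vector on $(\Omega,\mathcal{H},\mathbb{E})$ following the maximal distribution characterized by $G(p)=\mathbb{E}[\langle p,X_1\rangle]$, i.e. $\eta$ is maximal distributed and $\mathbb{E}[\langle p,\eta\rangle]=\mathbb{E}[\langle p,X_1\rangle]$ for all $p\in\mathbb{R}^d$. Then for every continuous function $\varphi:\mathbb{R}^d\to\mathbb{R}$ satisfying the linear growth condition $|\varphi(x)|\le C(1+|x|)$ for some $C>0$, $$\lim_{n\to\infty}\mathbb{E}\Big[\varphi\Big(\frac{1}{n}S_n\Big)\Big]=\mathbb{E}[\varphi(\eta)].$$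
   Context: Here $\mathbb{N}^+=\{1,2,\dots\}$. $C_{l,Lip}(\mathbb{R}^n)$ is the linear space of functions $\varphi:\mathbb{R}^n\to\mathbb{R}$ for which there are $C>0$ and $m\in\mathbb{N}$ with $|\varphi(x)-\varphi(y)|\le C(1+|x|^m+|y|^m)|x-y|$ for all $x,y\in\mathbb{R}^n$. Sublinear expectation space. A triple $(\Omega,\mathcal{H},\mathbb{E})$ where $\mathcal{H}$ is a set of real random variables on $\Omega$ such that $X_1,\dots,X_n\in\mathcal{H}$ implies $\varphi(X_1,\dots,X_n)\in\mathcal{H}$ for every $\varphi\in C_{l,Lip}(\mathbb{R}^n)$, and $\mathbb{E}:\mathcal{H}\to\mathbb{R}$ satisfies, for all $X,Y\in\mathcal{H}$: (1) monotonicity: $X\ge Y$ implies $\mathbb{E}[X]\ge\mathbb{E}[Y]$; (2) $\mathbb{E}[c]=c$ for all $c\in\mathbb{R}$; (3) $\mathbb{E}[X+Y]\le\mathbb{E}[X]+\mathbb{E}[Y]$; (4) $\mathbb{E}[\lambda X]=\lambda\mathbb{E}[X]$ for all $\lambda\ge0$. An $n$-dimensional random vector is $X=(X_1,\dots,X_n)$ with all $X_j\in\mathcal{H}$. Convention. For a $d$-dimensional random vector $Y$ and a continuous $\varphi$ of linear growth not in $C_{l,Lip}(\mathbb{R}^d)$, $\mathbb{E}[\varphi(Y)]$ denotes the (continuous) extension of $\mathbb{E}$, namely $\mathbb{E}[\varphi(Y)]=\inf\{\mathbb{E}[\psi(Y)]:\psi\in C_{l,Lip}(\mathbb{R}^d),\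 \psi\ge\varphi\}$; this agrees with the original value whenever $\varphi(Y)\in\mathcal{H}$. Identical distribution. $d$-dimensional random vectors $X,Y$ on $(\Omega,\mathcal{H},\mathbb{E})$ are identically distributed if $\mathbb{E}[\varphi(X)]=\mathbb{E}[\varphi(Y)]$ for every $\varphi\in C_{l,Lip}(\mathbb{R}^d)$. Convolution. For $d$-dimensional random vectors $X,Y$ on $(\Omega,\mathcal{H},\mathbb{E})$, "$Y$ and $X$ are of convolution" means $\mathbb{E}[\varphi(X+Y)]=\mathbb{E}\big[\mathbb{E}[\varphi(x+Y)]_{x=X}\big]$ for every $\varphi\in C_{l,Lip}(\mathbb{R}^d)$. A sequence $\{X_i\}_{i\ge1}$ is convolutionary if for all $n\in\mathbb{N}^+$ and $1\le k\le n$, with $S=\sum_{i=k}^{n}X_i$, one has $\mathbb{E}[\varphi(S+X_{n+1})]=\mathbb{E}\big[\mathbb{E}[\varphi(x+X_{n+1})]_{x=S}\big]$ for every $\varphi\in C_{l,Lip}(\mathbb{R}^d)$. Maximal distribution. A $d$-dimensional random vector $\eta$ on $(\Omega,\mathcal{H},\mathbb{E})$ is maximal distributed if there is a nonempty bounded, closed and convex set $\Gamma\subset\mathbb{R}^d$ with $\mathbb{E}[\varphi(\eta)]=\max_{x\in\Gamma}\varphi(x)$ for all $\varphi\in C_{l,Lip}(\mathbb{R}^d)$. *)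

theory Defs
  imports "HOL-Analysis.Analysis"
begin

definition C_l_Lip :: "('a::real_normed_vector \<Rightarrow> real) set" where
  "C_l_Lip = {\<phi>. \<exists>C>0. \<exists>m::nat. \<forall>x y.
     \<bar>\<phi> x - \<phi> y\<bar> \<le> C * (1 + norm x ^ m + norm y ^ m) * norm (x - y)}"

(* The same function space over R^n for a natural number n, needed because the closure property
   of a sublinear expectation space quantifies over all dimensions.  A point of R^n is represented
   by the first n entries of a sequence.  The Lipschitz condition forces \<phi> to ignore
   the remaining entries. *)
definition C_l_Lip_nat :: "nat \<Rightarrow> ((nat \<Rightarrow> real) \<Rightarrow> real) set" where
  "C_l_Lip_nat n = {\<phi>. \<exists>C>0. \<exists>m::nat. \<forall>x y.
     \<bar>\<phi> x - \<phi> y\<bar> \<le> C * (1 + L2_set x {..<n} ^ m + L2_set y {..<n} ^ m)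
                        * L2_set (\<lambda>i. x i - y i) {..<n}}"

lemma C_l_Lip_nat_cong:
  assumes "\<phi> \<in> C_l_Lip_nat n" and "\<And>i. i < n \<Longrightarrow> x i = y i"
  shows "\<phi> x = \<phi> y"
proof -
  obtain C and m :: nat where "\<And>x y. \<bar>\<phi> x - \<phi> y\<bar>
      \<le> C * (1 + L2_set x {..<n} ^ m + L2_set y {..<n} ^ m) * L2_set (\<lambda>i. x i - y i) {..<n}"
    using assms(1) by (auto simp: C_l_Lip_nat_def)
  moreover have "L2_set (\<lambda>i. x i - y i) {..<n} = 0"
    using assms(2) by (simp add: L2_set_eq_0_iff)
  ultimately have "\<bar>\<phi> x - \<phi> y\<bar> \<le> 0"
    by (metis mult_zero_right)
  then show ?thesis by simp
qed

(* The sample space is the type 'w, and E is a total function whose values outside H are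
   irrelevant. *)
locale sublinear_expectation_space =
  fixes H :: "('w \<Rightarrow> real) set" and E :: "('w \<Rightarrow> real) \<Rightarrow> real"
  assumes composition_closed: "\<lbrakk>n \<ge> 1; \<And>i. i < n \<Longrightarrow> Z i \<in> H; \<phi> \<in> C_l_Lip_nat n\<rbrakk>
      \<Longrightarrow> (\<lambda>\<omega>. \<phi> (\<lambda>i. Z i \<omega>)) \<in> H"
    and mono: "\<lbrakk>X \<in> H; Y \<in> H; \<And>\<omega>. X \<omega> \<ge> Y \<omega>\<rbrakk> \<Longrightarrow> E X \<ge> E Y"
    and const_mem: "(\<lambda>\<omega>. c) \<in> H"
    and const: "E (\<lambda>\<omega>. c) = c"
    and subadditive: "\<lbrakk>X \<in> H; Y \<in> H\<rbrakk> \<Longrightarrow> E (\<lambda>\<omega>. X \<omega> + Y \<omega>) \<le> E X + E Y"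
    and pos_homogeneous: "\<lbrakk>X \<in> H; l \<ge> 0\<rbrakk> \<Longrightarrow> E (\<lambda>\<omega>. l * X \<omega>) = l * E X"

definition random_vector :: "('w \<Rightarrow> real) set \<Rightarrow> ('w \<Rightarrow> real ^ 'd) \<Rightarrow> bool" where
  "random_vector H X \<longleftrightarrow> (\<forall>j. (\<lambda>\<omega>. X \<omega> $ j) \<in> H)"

definition identically_distributed ::
    "(('w \<Rightarrow> real) \<Rightarrow> real) \<Rightarrow> ('w \<Rightarrow> real ^ 'd) \<Rightarrow> ('w \<Rightarrow> real ^ 'd) \<Rightarrow> bool" where
  "identically_distributed E X Y \<longleftrightarrow>
     (\<forall>\<phi>\<in>C_l_Lip. E (\<lambda>\<omega>. \<phi> (X \<omega>)) = E (\<lambda>\<omega>. \<phi> (Y \<omega>)))"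

(* of_convolution E Y X: "Y and X are of convolution"; the order of the arguments matters. *)
definition of_convolution ::
    "(('w \<Rightarrow> real) \<Rightarrow> real) \<Rightarrow> ('w \<Rightarrow> real ^ 'd) \<Rightarrow> ('w \<Rightarrow> real ^ 'd) \<Rightarrow> bool" where
  "of_convolution E Y X \<longleftrightarrow>
     (\<forall>\<phi>\<in>C_l_Lip. E (\<lambda>\<omega>. \<phi> (X \<omega> + Y \<omega>)) = E (\<lambda>\<omega>. E (\<lambda>\<omega>'. \<phi> (X \<omega> + Y \<omega>'))))"

(* Sequences are indexed from 1; the entry X 0 is irrelevant. *)
definition convolutionary ::
    "(('w \<Rightarrow> real) \<Rightarrow> real) \<Rightarrow> (nat \<Rightarrow> 'w \<Rightarrow> real ^ 'd) \<Rightarrow> bool" where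
  "convolutionary E X \<longleftrightarrow>
     (\<forall>n k. 1 \<le> k \<and> k \<le> n \<longrightarrow> of_convolution E (X (n + 1)) (\<lambda>\<omega>. \<Sum>i=k..n. X i \<omega>))"

definition maximal_distributed ::
    "(('w \<Rightarrow> real) \<Rightarrow> real) \<Rightarrow> ('w \<Rightarrow> real ^ 'd) \<Rightarrow> bool" where
  "maximal_distributed E \<eta> \<longleftrightarrow>
     (\<exists>\<Gamma>. \<Gamma> \<noteq> {} \<and> bounded \<Gamma> \<and> closed \<Gamma> \<and> convex \<Gamma> \<and>
        (\<forall>\<phi>\<in>C_l_Lip. E (\<lambda>\<omega>. \<phi> (\<eta> \<omega>)) \<in> \<phi> ` \<Gamma> \<and> (\<forall>x\<in>\<Gamma>. \<phi> x \<le> E (\<lambda>\<omega>. \<phi> (\<eta> \<omega>)))))"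

(* The extension of the expectation E[\<phi>(Y)] to continuous \<phi> of linear growth, for which
   the infimum is over a nonempty set that is bounded below. *)
definition ext_expectation ::
    "(('w \<Rightarrow> real) \<Rightarrow> real) \<Rightarrow> (real ^ 'd \<Rightarrow> real) \<Rightarrow> ('w \<Rightarrow> real ^ 'd) \<Rightarrow> real" where
  "ext_expectation E \<phi> Y =
     Inf {E (\<lambda>\<omega>. \<psi> (Y \<omega>)) | \<psi>. \<psi> \<in> C_l_Lip \<and> (\<forall>x. \<phi> x \<le> \<psi> x)}"

context sublinear_expectation_space
begin

lemma C_l_Lip_random_vector:
  fixes X :: "'w \<Rightarrow> real ^ 'd"
  assumes X: "random_vector H X" and \<phi>: "\<phi> \<in> C_l_Lip"
  shows "(\<lambda>\<omega>. \<phi> (X \<omega>)) \<in> H"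
proof -
  obtain e where e: "bij_betw e {..<CARD('d)} (UNIV :: 'd set)"
    using ex_bij_betw_nat_finite[of "UNIV :: 'd set"] by (auto simp: atLeast0LessThan)
  define e' where "e' = the_inv_into {..<CARD('d)} e"
  have e'_e: "e' (e i) = i" if "i < CARD('d)" for i
    using that e by (simp add: e'_def the_inv_into_f_f bij_betw_def)
  have e_e': "e (e' j) = j" for j
    using e f_the_inv_into_f_bij_betw[OF e, of j] by (simp add: e'_def)
  define v :: "(nat \<Rightarrow> real) \<Rightarrow> real ^ 'd" where "v = (\<lambda>x. \<chi> j. x (e' j))"
  have norm_v: "norm (v x) = L2_set x {..<CARD('d)}" for x
  proof -
    have "(\<Sum>j\<in>UNIV. (x (e' j))\<^sup>2) = (\<Sum>i<CARD('d). (x (e' (e i)))\<^sup>2)"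
      by (rule sum.reindex_bij_betw[OF e, symmetric])
    also have "\<dots> = (\<Sum>i<CARD('d). (x i)\<^sup>2)"
      by (intro sum.cong) (auto simp: e'_e)
    finally show ?thesis
      by (simp add: norm_vec_def L2_set_def v_def)
  qed
  have v_diff: "v x - v y = v (\<lambda>i. x i - y i)" for x y
    by (simp add: v_def vec_eq_iff)
  obtain C and m :: nat where "C > 0"
    and lip: "\<And>x y. \<bar>\<phi> x - \<phi> y\<bar> \<le> C * (1 + norm x ^ m + norm y ^ m) * norm (x - y)"
    using \<phi> by (auto simp: C_l_Lip_def)
  have "\<bar>\<phi> (v x) - \<phi> (v y)\<bar>
      \<le> C * (1 + L2_set x {..<CARD('d)} ^ m + L2_set y {..<CARD('d)} ^ m)
        * L2_set (\<lambda>i. x i - y i) {..<CARD('d)}" for x y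
    using lip[of "v x" "v y"] by (simp only: v_diff norm_v)
  with \<open>C > 0\<close> have "(\<lambda>x. \<phi> (v x)) \<in> C_l_Lip_nat CARD('d)"
    unfolding C_l_Lip_nat_def by blast
  moreover have "(\<lambda>\<omega>. X \<omega> $ e i) \<in> H" for i
    using X by (simp add: random_vector_def)
  moreover have "1 \<le> CARD('d)"
    by (simp add: Suc_le_eq)
  ultimately have "(\<lambda>\<omega>. \<phi> (v (\<lambda>i. X \<omega> $ e i))) \<in> H"
    using composition_closed[of "CARD('d)" "\<lambda>i \<omega>. X \<omega> $ e i" "\<lambda>x. \<phi> (v x)"] by blast
  moreover have "v (\<lambda>i. X \<omega> $ e i) = X \<omega>" for \<omega>
    by (simp add: v_def e_e' vec_eq_iff)
  ultimately show ?thesis by simp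
qed

lemma ext_expectation_eq:
  fixes Y :: "'w \<Rightarrow> real ^ 'd"
  assumes "random_vector H Y" and "\<phi> \<in> C_l_Lip"
  shows "ext_expectation E \<phi> Y = E (\<lambda>\<omega>. \<phi> (Y \<omega>))"
  unfolding ext_expectation_def
proof (rule cInf_eq_minimum)
  show "E (\<lambda>\<omega>. \<phi> (Y \<omega>)) \<in> {E (\<lambda>\<omega>. \<psi> (Y \<omega>)) | \<psi>. \<psi> \<in> C_l_Lip \<and> (\<forall>x. \<phi> x \<le> \<psi> x)}"
    using assms by blast
next
  fix r assume "r \<in> {E (\<lambda>\<omega>. \<psi> (Y \<omega>)) | \<psi>. \<psi> \<in> C_l_Lip \<and> (\<forall>x. \<phi> x \<le> \<psi> x)}"
  then obtain \<psi> where "r = E (\<lambda>\<omega>. \<psi> (Y \<omega>))" "\<psi> \<in> C_l_Lip" "\<And>x. \<phi> x \<le> \<psi> x"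
    by blast
  with assms show "E (\<lambda>\<omega>. \<phi> (Y \<omega>)) \<le> r"
    by (simp add: mono C_l_Lip_random_vector)
qed

end

end

theory Submission
  imports Defs
begin

text \<open>
  For a test function \<open>f\<close> let \<open>T f x = E[f (x + X\<^sub>1)]\<close>. Convolutionarity and identical distribution
  give \<open>E[f (S\<^sub>n\<^sub>+\<^sub>1)] = E[(T f) (S\<^sub>n)]\<close>, so the partial sums behave like a Markov chain with a
  sublinear one-step operator \<open>T\<close>. Consequently a one-step inequality \<open>T f\<^sub>n\<^sub>+\<^sub>1 \<le> f\<^sub>n + c\<close> between
  functions sums up to \<open>E[f\<^sub>n (S\<^sub>n)] \<le> f\<^sub>0 0 + n c\<close>, and likewise from below.

  Let \<open>\<Gamma>\<close> be the compact convex set of the maximal distribution. Its support function is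
  \<open>p \<mapsto> E[\<langle>p, X\<^sub>1\<rangle>]\<close>. Two families of quadratic functions satisfy such one-step inequalities with
  the error \<open>V\<close>, a bound of \<open>E[|X\<^sub>1 - g|\<^sup>2]\<close> that is uniform over \<open>g \<in> \<Gamma>\<close>:

  \<^item> \<open>f\<^sub>n x = d(x, n\<Gamma>)\<^sup>2\<close>. Let \<open>n a\<close> be a point of \<open>n\<Gamma>\<close> closest to \<open>x\<close>, let \<open>q = x - n a\<close>, and let
    \<open>g \<in> \<Gamma>\<close> satisfy \<open>\<langle>q, g\<rangle> = E[\<langle>q, X\<^sub>1\<rangle>]\<close>. By convexity \<open>n a + g\<close> lies in \<open>(n + 1)\<Gamma>\<close>, hence
    \<open>f\<^sub>n\<^sub>+\<^sub>1 (x + X\<^sub>1) \<le> |q|\<^sup>2 + 2 \<langle>q, X\<^sub>1 - g\<rangle> + |X\<^sub>1 - g|\<^sup>2\<close>, and the choice of \<open>g\<close> makes the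
    expectation of the middle term vanish. This gives \<open>E[d(S\<^sub>n/n, \<Gamma>)\<^sup>2] \<le> V/n\<close>
    (\<open>expectation_infdist_sq_le\<close>): asymptotically, the means do not leave \<open>\<Gamma>\<close>.

  \<^item> \<open>f\<^sub>n x = - |x - n g|\<^sup>2\<close> for a fixed \<open>g \<in> \<Gamma>\<close>. Here the cross term has nonnegative expectation,
    because \<open>\<langle>p, g\<rangle>\<close> is at most the support function at \<open>p\<close>. This gives
    \<open>E[- |S\<^sub>n/n - g|\<^sup>2] \<ge> - V/n\<close> (\<open>expectation_minus_dist_sq_ge\<close>): under a sublinear expectation,
    the means can be steered to any point of \<open>\<Gamma>\<close>.

  Finally let \<open>g\<close> maximise \<open>\<phi>\<close> over \<open>\<Gamma>\<close>. Compactness and linear growth yield, for each \<open>\<epsilon> > 0\<close>,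
  constants with \<open>\<phi> g - \<epsilon> - L |x - g|\<^sup>2 \<le> \<phi> x \<le> \<phi> g + \<epsilon> + K d(x, \<Gamma>)\<^sup>2\<close>
  (\<open>quadratic_majorant\<close>). Both bounds belong to the test class, so they control the extended
  expectation of \<open>\<phi>\<close> directly. At \<open>S\<^sub>n/n\<close> they give \<open>\<phi> g\<close> up to \<open>\<epsilon> + O(1/n)\<close>, and at \<open>\<eta>\<close> they give \<open>\<phi> g\<close> up to \<open>\<epsilon>\<close>.
\<close>

section \<open>Locally Lipschitz functions of polynomial growth\<close>

text \<open>
  With the single weight \<open>(1 + |x| + |y|) ^ m\<close> instead of a sum of powers, weights multiply by adding
  exponents, which reduces the closure properties below to monotonicity of powers.
\<close>

lemma C_l_Lip_iff:
  fixes f :: "'a::real_normed_vector \<Rightarrow> real"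
  shows "f \<in> C_l_Lip \<longleftrightarrow>
    (\<exists>C\<ge>0. \<exists>m. \<forall>x y. \<bar>f x - f y\<bar> \<le> C * (1 + norm x + norm y) ^ m * norm (x - y))"
proof
  assume "f \<in> C_l_Lip"
  then obtain C and m :: nat where C: "C > 0"
    and lip: "\<And>x y. \<bar>f x - f y\<bar> \<le> C * (1 + norm x ^ m + norm y ^ m) * norm (x - y)"
    by (auto simp: C_l_Lip_def)
  have "\<bar>f x - f y\<bar> \<le> (3 * C) * (1 + norm x + norm y) ^ m * norm (x - y)" for x y
  proof -
    have "1 \<le> (1 + norm x + norm y) ^ m"
      by (intro one_le_power) simp
    moreover have "norm x ^ m \<le> (1 + norm x + norm y) ^ m" "norm y ^ m \<le> (1 + norm x + norm y) ^ m"
      by (intro power_mono; simp)+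
    ultimately have "1 + norm x ^ m + norm y ^ m \<le> 3 * (1 + norm x + norm y) ^ m"
      by linarith
    then have "C * (1 + norm x ^ m + norm y ^ m) * norm (x - y)
        \<le> C * (3 * (1 + norm x + norm y) ^ m) * norm (x - y)"
      using C by (intro mult_right_mono mult_left_mono) auto
    with lip[of x y] show ?thesis by (simp add: mult_ac)
  qed
  with C show "\<exists>C\<ge>0. \<exists>m. \<forall>x y. \<bar>f x - f y\<bar> \<le> C * (1 + norm x + norm y) ^ m * norm (x - y)"
    by (intro exI[of _ "3 * C"] conjI exI[of _ m]) auto
next
  assume "\<exists>C\<ge>0. \<exists>m. \<forall>x y. \<bar>f x - f y\<bar> \<le> C * (1 + norm x + norm y) ^ m * norm (x - y)"
  then obtain C and m :: nat where C: "C \<ge> 0"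
    and lip: "\<And>x y. \<bar>f x - f y\<bar> \<le> C * (1 + norm x + norm y) ^ m * norm (x - y)"
    by auto
  have "\<bar>f x - f y\<bar> \<le> (C * 3 ^ m + 1) * (1 + norm x ^ m + norm y ^ m) * norm (x - y)" for x y
  proof -
    define a where "a = max 1 (max (norm x) (norm y))"
    have "(1 + norm x + norm y) ^ m \<le> (3 * a) ^ m"
      by (intro power_mono) (auto simp: a_def)
    also have "\<dots> = 3 ^ m * a ^ m" by (rule power_mult_distrib)
    also have "a ^ m \<le> 1 + norm x ^ m + norm y ^ m"
      by (auto simp: a_def max_def)
    finally have "(1 + norm x + norm y) ^ m \<le> 3 ^ m * (1 + norm x ^ m + norm y ^ m)"
      by simp
    then have "C * (1 + norm x + norm y) ^ m \<le> C * (3 ^ m * (1 + norm x ^ m + norm y ^ m))"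
      using C by (rule mult_left_mono)
    also have "\<dots> \<le> (C * 3 ^ m + 1) * (1 + norm x ^ m + norm y ^ m)"
      by (simp add: algebra_simps)
    finally show ?thesis
      using lip[of x y] by (meson mult_right_mono norm_ge_zero order_trans)
  qed
  moreover have "C * 3 ^ m + 1 > 0" using C by (simp add: add_nonneg_pos)
  ultimately show "f \<in> C_l_Lip"
    unfolding C_l_Lip_def by blast
qed

text \<open>
  The growth bound is the Lipschitz estimate against the origin. One constant and one exponent for
  both estimates keep the product rule for \<open>f x g x - f y g y\<close> short.
\<close>

lemma C_l_Lip_growth:
  fixes f :: "'a::real_normed_vector \<Rightarrow> real"
  assumes "f \<in> C_l_Lip"
  obtains C m where "C \<ge> 0" "\<And>x. \<bar>f x\<bar> \<le> C * (1 + norm x) ^ m"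
    "\<And>x y. \<bar>f x - f y\<bar> \<le> C * (1 + norm x + norm y) ^ m * norm (x - y)"
proof -
  obtain C and m :: nat where C: "C \<ge> 0"
    and lip: "\<And>x y. \<bar>f x - f y\<bar> \<le> C * (1 + norm x + norm y) ^ m * norm (x - y)"
    using assms unfolding C_l_Lip_iff by auto
  show ?thesis
  proof (rule that[of "\<bar>f 0\<bar> + C" "Suc m"])
    show "\<bar>f 0\<bar> + C \<ge> 0" using C by simp
    fix x y :: 'a
    have "\<bar>f x\<bar> \<le> \<bar>f 0\<bar> + C * (1 + norm x) ^ m * norm x"
      using lip[of x 0] by simp
    also have "C * (1 + norm x) ^ m * norm x \<le> C * (1 + norm x) ^ m * (1 + norm x)"
      using C by (intro mult_left_mono) auto
    also have "\<bar>f 0\<bar> \<le> \<bar>f 0\<bar> * (1 + norm x) ^ Suc m"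
      by (metis abs_ge_zero le_add_same_cancel1 mult_cancel_left1 mult_left_mono norm_ge_zero one_le_power)
    finally show "\<bar>f x\<bar> \<le> (\<bar>f 0\<bar> + C) * (1 + norm x) ^ Suc m"
      by (simp add: algebra_simps)
    have "C * (1 + norm x + norm y) ^ m \<le> (\<bar>f 0\<bar> + C) * (1 + norm x + norm y) ^ Suc m"
      using C by (intro mult_mono power_increasing) (auto simp: add_nonneg_nonneg)
    then show "\<bar>f x - f y\<bar> \<le> (\<bar>f 0\<bar> + C) * (1 + norm x + norm y) ^ Suc m * norm (x - y)"
      using lip[of x y] by (meson mult_right_mono norm_ge_zero order_trans)
  qed
qed

lemma C_l_Lip_lipschitz:
  fixes f :: "'a::real_normed_vector \<Rightarrow> real"
  assumes "L \<ge> 0" "\<And>x y. \<bar>f x - f y\<bar> \<le> L * norm (x - y)"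
  shows "f \<in> C_l_Lip"
  unfolding C_l_Lip_iff using assms by (intro exI[of _ L] conjI exI[of _ 0]) auto

lemma C_l_Lip_const: "(\<lambda>x::'a::real_normed_vector. c) \<in> C_l_Lip"
  by (rule C_l_Lip_lipschitz[of 0]) auto

lemma C_l_Lip_norm: "(norm :: 'a::real_normed_vector \<Rightarrow> real) \<in> C_l_Lip"
  by (rule C_l_Lip_lipschitz[of 1]) (auto simp: norm_triangle_ineq3)

lemma C_l_Lip_inner: "(\<lambda>x::'a::real_inner. p \<bullet> x) \<in> C_l_Lip"
  by (rule C_l_Lip_lipschitz[of "norm p"])
    (auto simp: inner_diff_right[symmetric] Cauchy_Schwarz_ineq2)

lemma C_l_Lip_infdist: "(\<lambda>x::'a::real_normed_vector. infdist x A) \<in> C_l_Lip"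
  by (rule C_l_Lip_lipschitz[of 1]) (auto simp: infdist_triangle_abs dist_norm[symmetric])

lemma C_l_Lip_add:
  fixes f g :: "'a::real_normed_vector \<Rightarrow> real"
  assumes "f \<in> C_l_Lip" "g \<in> C_l_Lip"
  shows "(\<lambda>x. f x + g x) \<in> C_l_Lip"
proof -
  obtain C m where C: "C \<ge> 0"
    and f: "\<And>x y. \<bar>f x - f y\<bar> \<le> C * (1 + norm x + norm y) ^ m * norm (x - y)"
    using C_l_Lip_growth[OF assms(1)] by metis
  obtain D n where D: "D \<ge> 0"
    and g: "\<And>x y. \<bar>g x - g y\<bar> \<le> D * (1 + norm x + norm y) ^ n * norm (x - y)"
    using C_l_Lip_growth[OF assms(2)] by metis
  have "\<bar>(f x + g x) - (f y + g y)\<bar> \<le> (C + D) * (1 + norm x + norm y) ^ (m + n) * norm (x - y)"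
    for x y
  proof -
    let ?b = "1 + norm x + norm y"
    have b: "?b \<ge> 1" by simp
    have "\<bar>(f x + g x) - (f y + g y)\<bar> \<le> C * ?b ^ m * norm (x - y) + D * ?b ^ n * norm (x - y)"
      using f[of x y] g[of x y] by linarith
    also have "\<dots> \<le> C * ?b ^ (m + n) * norm (x - y) + D * ?b ^ (m + n) * norm (x - y)"
      using C D b by (intro add_mono mult_right_mono mult_left_mono power_increasing) auto
    finally show ?thesis by (simp add: algebra_simps)
  qed
  then show ?thesis
    unfolding C_l_Lip_iff using C D by (intro exI[of _ "C + D"] conjI exI[of _ "m + n"]) auto
qed

lemma C_l_Lip_mult:
  fixes f g :: "'a::real_normed_vector \<Rightarrow> real"
  assumes "f \<in> C_l_Lip" "g \<in> C_l_Lip"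
  shows "(\<lambda>x. f x * g x) \<in> C_l_Lip"
proof -
  obtain C m where C: "C \<ge> 0" and f0: "\<And>x. \<bar>f x\<bar> \<le> C * (1 + norm x) ^ m"
    and f: "\<And>x y. \<bar>f x - f y\<bar> \<le> C * (1 + norm x + norm y) ^ m * norm (x - y)"
    using C_l_Lip_growth[OF assms(1)] by metis
  obtain D n where D: "D \<ge> 0" and g0: "\<And>x. \<bar>g x\<bar> \<le> D * (1 + norm x) ^ n"
    and g: "\<And>x y. \<bar>g x - g y\<bar> \<le> D * (1 + norm x + norm y) ^ n * norm (x - y)"
    using C_l_Lip_growth[OF assms(2)] by metis
  have "\<bar>f x * g x - f y * g y\<bar> \<le> (2 * C * D) * (1 + norm x + norm y) ^ (m + n) * norm (x - y)"
    for x y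
  proof -
    let ?b = "1 + norm x + norm y"
    have "\<bar>f x\<bar> \<le> C * ?b ^ m"
      by (rule order_trans[OF f0]) (use C in \<open>intro mult_left_mono power_mono; simp\<close>)
    moreover have "\<bar>g y\<bar> \<le> D * ?b ^ n"
      by (rule order_trans[OF g0]) (use D in \<open>intro mult_left_mono power_mono; simp\<close>)
    ultimately have "\<bar>f x\<bar> * \<bar>g x - g y\<bar> + \<bar>g y\<bar> * \<bar>f x - f y\<bar>
        \<le> (C * ?b ^ m) * (D * ?b ^ n * norm (x - y)) + (D * ?b ^ n) * (C * ?b ^ m * norm (x - y))"
      using C D by (intro add_mono mult_mono f g) auto
    moreover have "f x * g x - f y * g y = f x * (g x - g y) + g y * (f x - f y)"
      by (simp add: algebra_simps)
    then have "\<bar>f x * g x - f y * g y\<bar> \<le> \<bar>f x\<bar> * \<bar>g x - g y\<bar> + \<bar>g y\<bar> * \<bar>f x - f y\<bar>"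
      by (metis abs_mult abs_triangle_ineq)
    ultimately show ?thesis by (simp add: algebra_simps power_add)
  qed
  then show ?thesis
    unfolding C_l_Lip_iff using C D by (intro exI[of _ "2 * C * D"] conjI exI[of _ "m + n"]) auto
qed

lemma C_l_Lip_cmult:
  fixes f :: "'a::real_normed_vector \<Rightarrow> real"
  shows "f \<in> C_l_Lip \<Longrightarrow> (\<lambda>x. c * f x) \<in> C_l_Lip"
  by (rule C_l_Lip_mult[OF C_l_Lip_const])

lemma C_l_Lip_minus:
  fixes f :: "'a::real_normed_vector \<Rightarrow> real"
  shows "f \<in> C_l_Lip \<Longrightarrow> (\<lambda>x. - f x) \<in> C_l_Lip"
  using C_l_Lip_cmult[of f "-1"] by simp

lemma C_l_Lip_diff:
  fixes f g :: "'a::real_normed_vector \<Rightarrow> real"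
  shows "f \<in> C_l_Lip \<Longrightarrow> g \<in> C_l_Lip \<Longrightarrow> (\<lambda>x. f x - g x) \<in> C_l_Lip"
  using C_l_Lip_add[OF _ C_l_Lip_minus[of g], of f] by simp

lemma C_l_Lip_power:
  fixes f :: "'a::real_normed_vector \<Rightarrow> real"
  shows "f \<in> C_l_Lip \<Longrightarrow> (\<lambda>x. f x ^ k) \<in> C_l_Lip"
  by (induction k) (simp_all add: C_l_Lip_const C_l_Lip_mult)

lemma C_l_Lip_affine:
  fixes f :: "'a::real_normed_vector \<Rightarrow> real"
  assumes "f \<in> C_l_Lip"
  shows "(\<lambda>x. f (a + c *\<^sub>R x)) \<in> C_l_Lip"
proof -
  obtain C m where C: "C \<ge> 0"
    and f: "\<And>x y. \<bar>f x - f y\<bar> \<le> C * (1 + norm x + norm y) ^ m * norm (x - y)"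
    using C_l_Lip_growth[OF assms] by metis
  define B where "B = 1 + 2 * norm a + \<bar>c\<bar>"
  have "\<bar>f (a + c *\<^sub>R x) - f (a + c *\<^sub>R y)\<bar>
      \<le> (C * B ^ m * \<bar>c\<bar>) * (1 + norm x + norm y) ^ m * norm (x - y)" for x y
  proof -
    have "norm (a + c *\<^sub>R x) \<le> norm a + \<bar>c\<bar> * norm x" "norm (a + c *\<^sub>R y) \<le> norm a + \<bar>c\<bar> * norm y"
      by (metis norm_scaleR norm_triangle_ineq)+
    then have "1 + norm (a + c *\<^sub>R x) + norm (a + c *\<^sub>R y) \<le> 1 + 2 * norm a + \<bar>c\<bar> * (norm x + norm y)"
      by (simp add: algebra_simps)
    also have "\<dots> \<le> B * (1 + norm x + norm y)"
    proof -
      have "0 \<le> (1 + 2 * norm a) * (norm x + norm y) + \<bar>c\<bar>" by simp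
      then show ?thesis by (simp add: B_def algebra_simps)
    qed
    finally have "(1 + norm (a + c *\<^sub>R x) + norm (a + c *\<^sub>R y)) ^ m \<le> B ^ m * (1 + norm x + norm y) ^ m"
      by (metis add_nonneg_nonneg norm_ge_zero power_mono power_mult_distrib zero_le_one)
    then have "C * (1 + norm (a + c *\<^sub>R x) + norm (a + c *\<^sub>R y)) ^ m * (\<bar>c\<bar> * norm (x - y))
        \<le> C * (B ^ m * (1 + norm x + norm y) ^ m) * (\<bar>c\<bar> * norm (x - y))"
      using C by (intro mult_right_mono mult_left_mono) auto
    moreover have "norm (a + c *\<^sub>R x - (a + c *\<^sub>R y)) = \<bar>c\<bar> * norm (x - y)"
      by (simp add: scaleR_diff_right[symmetric])
    ultimately show ?thesis
      using f[of "a + c *\<^sub>R x" "a + c *\<^sub>R y"] by (simp add: mult_ac)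
  qed
  moreover have "C * B ^ m * \<bar>c\<bar> \<ge> 0" using C by (simp add: B_def)
  ultimately show ?thesis unfolding C_l_Lip_iff by blast
qed

lemmas C_l_Lip_translate = C_l_Lip_affine[where c = 1, simplified]
  and C_l_Lip_scale = C_l_Lip_affine[where a = 0, simplified]

lemma C_l_Lip_norm_minus_power: "(\<lambda>x::'a::real_normed_vector. norm (x - a) ^ k) \<in> C_l_Lip"
  using C_l_Lip_power[OF C_l_Lip_translate[OF C_l_Lip_norm, of "- a"], of k] by simp

lemmas C_l_Lip_intros = C_l_Lip_const C_l_Lip_norm C_l_Lip_inner C_l_Lip_infdist C_l_Lip_add
  C_l_Lip_cmult C_l_Lip_minus C_l_Lip_diff C_l_Lip_power C_l_Lip_norm_minus_power

section \<open>Calculus of sublinear expectations\<close>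

context sublinear_expectation_space
begin

text \<open>
  Closure of \<open>H\<close> under addition is the composition axiom for the function \<open>x\<^sub>0 + x\<^sub>1\<close> on the plane.
\<close>

lemma add_mem:
  assumes "Y \<in> H" "Z \<in> H"
  shows "(\<lambda>\<omega>. Y \<omega> + Z \<omega>) \<in> H"
proof -
  have "(\<lambda>x. x 0 + x 1) \<in> C_l_Lip_nat 2"
  proof -
    have "\<bar>(x 0 + x 1) - (y 0 + y 1)\<bar> \<le> 1 * (1 + L2_set x {..<2} ^ 0 + L2_set y {..<2} ^ 0)
        * L2_set (\<lambda>i. x i - y i) {..<2}" for x y :: "nat \<Rightarrow> real"
    proof -
      have *: "\<bar>x i - y i\<bar> \<le> L2_set (\<lambda>i. x i - y i) {..<2}" if "i < 2" for i
        using member_le_L2_set[of "{..<2::nat}" i "\<lambda>i. \<bar>x i - y i\<bar>"] that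
        by (simp add: L2_set_def)
      show ?thesis using *[of 0] *[of 1] by simp
    qed
    then show ?thesis unfolding C_l_Lip_nat_def by (intro CollectI exI[of _ 1] conjI exI[of _ 0]) auto
  qed
  from composition_closed[OF _ _ this, of "\<lambda>i. if i = 0 then Y else Z"] assms show ?thesis
    by simp
qed

lemma random_vector_add:
  assumes "random_vector H Y" "random_vector H Z"
  shows "random_vector H (\<lambda>\<omega>. Y \<omega> + Z \<omega>)"
  using assms by (simp add: random_vector_def add_mem)

lemma random_vector_sum:
  assumes "\<And>i. i \<in> A \<Longrightarrow> random_vector H (Z i)"
  shows "random_vector H (\<lambda>\<omega>. \<Sum>i\<in>A. Z i \<omega>)"
proof (cases "finite A")
  case True
  then show ?thesis using assms
    by induction (auto simp: random_vector_add, simp add: random_vector_def const_mem)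
qed (simp add: random_vector_def const_mem)

lemma random_vector_scaleR:
  fixes Z :: "'w \<Rightarrow> real ^ 'd"
  assumes "random_vector H Z"
  shows "random_vector H (\<lambda>\<omega>. c *\<^sub>R Z \<omega>)"
  unfolding random_vector_def
proof
  fix j
  have "(\<lambda>x::real ^ 'd. c *\<^sub>R (x $ j)) \<in> C_l_Lip"
    using C_l_Lip_cmult[OF C_l_Lip_inner[of "axis j (1::real)"], of c] by (simp add: inner_axis')
  from C_l_Lip_random_vector[OF assms this] show "(\<lambda>\<omega>. (c *\<^sub>R Z \<omega>) $ j) \<in> H" by simp
qed

lemma mono_C_l_Lip:
  assumes "random_vector H Z" "f \<in> C_l_Lip" "g \<in> C_l_Lip" "\<And>x. f x \<le> g x"
  shows "E (\<lambda>\<omega>. f (Z \<omega>)) \<le> E (\<lambda>\<omega>. g (Z \<omega>))"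
  using assms by (intro mono C_l_Lip_random_vector)

lemma subadditive_C_l_Lip:
  assumes "random_vector H Z" "f \<in> C_l_Lip" "g \<in> C_l_Lip"
  shows "E (\<lambda>\<omega>. f (Z \<omega>) + g (Z \<omega>)) \<le> E (\<lambda>\<omega>. f (Z \<omega>)) + E (\<lambda>\<omega>. g (Z \<omega>))"
  using assms by (intro subadditive C_l_Lip_random_vector)

text \<open>
  Constants split off with equality: subadditivity applied to \<open>c + Y\<close> gives one inequality, and
  applied to \<open>Y = (c + Y) + (- c)\<close> it gives the other.
\<close>

lemma affine_C_l_Lip:
  assumes Z: "random_vector H Z" and f: "f \<in> C_l_Lip" and "k \<ge> 0"
  shows "E (\<lambda>\<omega>. c + k * f (Z \<omega>)) = c + k * E (\<lambda>\<omega>. f (Z \<omega>))"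
proof -
  have kf: "(\<lambda>x. k * f x) \<in> C_l_Lip" by (rule C_l_Lip_cmult[OF f])
  have hom: "E (\<lambda>\<omega>. k * f (Z \<omega>)) = k * E (\<lambda>\<omega>. f (Z \<omega>))"
    by (rule pos_homogeneous[OF C_l_Lip_random_vector[OF Z f] \<open>k \<ge> 0\<close>])
  show ?thesis
  proof (rule antisym)
    show "E (\<lambda>\<omega>. c + k * f (Z \<omega>)) \<le> c + k * E (\<lambda>\<omega>. f (Z \<omega>))"
      using subadditive_C_l_Lip[OF Z C_l_Lip_const kf, of c] by (simp add: const hom)
    show "c + k * E (\<lambda>\<omega>. f (Z \<omega>)) \<le> E (\<lambda>\<omega>. c + k * f (Z \<omega>))"
      using subadditive_C_l_Lip[OF Z C_l_Lip_add[OF C_l_Lip_const kf] C_l_Lip_const, of c "- c"]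
      by (simp add: const hom)
  qed
qed

lemma abs_diff_le:
  assumes "random_vector H Z" "f \<in> C_l_Lip" "g \<in> C_l_Lip" "h \<in> C_l_Lip"
    and "\<And>x. \<bar>f x - g x\<bar> \<le> h x"
  shows "\<bar>E (\<lambda>\<omega>. f (Z \<omega>)) - E (\<lambda>\<omega>. g (Z \<omega>))\<bar> \<le> E (\<lambda>\<omega>. h (Z \<omega>))"
proof -
  have "E (\<lambda>\<omega>. f (Z \<omega>)) \<le> E (\<lambda>\<omega>. g (Z \<omega>) + h (Z \<omega>))" "E (\<lambda>\<omega>. g (Z \<omega>)) \<le> E (\<lambda>\<omega>. f (Z \<omega>) + h (Z \<omega>))"
    using assms(5) by (intro mono_C_l_Lip assms C_l_Lip_intros; smt (verit))+
  moreover note subadditive_C_l_Lip[OF assms(1,2,4)] subadditive_C_l_Lip[OF assms(1,3,4)]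
  ultimately show ?thesis by linarith
qed

text \<open>
  The one-step operator \<open>T\<close> preserves the test class. Monotonicity of the outer expectation in
  \<open>E[(T f) (S n)]\<close> may only be used because of this. The polynomial weight factorises as
  \<open>1 + |x + z| + |y + z| \<le> (1 + |x| + |y|) (1 + 2 |z|)\<close>, and every moment of \<open>Z\<close> is finite because
  the powers of \<open>1 + 2 |Z|\<close> lie in \<open>H\<close>.
\<close>

lemma C_l_Lip_shifted_expectation:
  fixes Z :: "'w \<Rightarrow> real ^ 'd"
  assumes Z: "random_vector H Z" and f: "f \<in> C_l_Lip"
  shows "(\<lambda>x. E (\<lambda>\<omega>. f (x + Z \<omega>))) \<in> C_l_Lip"
proof -
  obtain C m where C: "C \<ge> 0"
    and lip: "\<And>x y. \<bar>f x - f y\<bar> \<le> C * (1 + norm x + norm y) ^ m * norm (x - y)"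
    using C_l_Lip_growth[OF f] by metis
  have moment: "(\<lambda>z::real ^ 'd. (1 + 2 * norm z) ^ m) \<in> C_l_Lip"
    by (intro C_l_Lip_intros)
  define B where "B = E (\<lambda>\<omega>. (1 + 2 * norm (Z \<omega>)) ^ m)"
  have "E (\<lambda>\<omega>. 0) \<le> B"
    unfolding B_def by (rule mono_C_l_Lip[OF Z C_l_Lip_const moment]) simp
  then have "B \<ge> 0" by (simp add: const)
  have "\<bar>E (\<lambda>\<omega>. f (x + Z \<omega>)) - E (\<lambda>\<omega>. f (y + Z \<omega>))\<bar>
      \<le> (C * B) * (1 + norm x + norm y) ^ m * norm (x - y)" for x y
  proof -
    let ?k = "C * (1 + norm x + norm y) ^ m * norm (x - y)"
    have k: "?k \<ge> 0" using C by simp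
    have "\<bar>f (x + z) - f (y + z)\<bar> \<le> ?k * (1 + 2 * norm z) ^ m" for z
    proof -
      have "1 + norm (x + z) + norm (y + z) \<le> 1 + norm x + norm y + 2 * norm z"
        using norm_triangle_ineq[of x z] norm_triangle_ineq[of y z] by simp
      also have "\<dots> \<le> (1 + norm x + norm y) * (1 + 2 * norm z)"
      proof -
        have "0 \<le> (norm x + norm y) * (2 * norm z)" by simp
        then show ?thesis by (simp add: algebra_simps)
      qed
      finally have "(1 + norm (x + z) + norm (y + z)) ^ m
          \<le> (1 + norm x + norm y) ^ m * (1 + 2 * norm z) ^ m"
        by (metis add_nonneg_nonneg norm_ge_zero power_mono power_mult_distrib zero_le_one)
      then have "C * (1 + norm (x + z) + norm (y + z)) ^ m * norm (x - y)
          \<le> C * ((1 + norm x + norm y) ^ m * (1 + 2 * norm z) ^ m) * norm (x - y)"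
        using C by (intro mult_right_mono mult_left_mono) auto
      with lip[of "x + z" "y + z"] show ?thesis by (simp add: mult_ac)
    qed
    then have "\<bar>E (\<lambda>\<omega>. f (x + Z \<omega>)) - E (\<lambda>\<omega>. f (y + Z \<omega>))\<bar>
        \<le> E (\<lambda>\<omega>. ?k * (1 + 2 * norm (Z \<omega>)) ^ m)"
      by (intro abs_diff_le[OF Z] C_l_Lip_translate[OF f] C_l_Lip_cmult moment)
    also have "\<dots> = ?k * B"
      using affine_C_l_Lip[OF Z moment k, of 0] by (simp add: B_def)
    finally show ?thesis by (simp add: mult_ac)
  qed
  moreover have "C * B \<ge> 0" using C \<open>B \<ge> 0\<close> by simp
  ultimately show ?thesis unfolding C_l_Lip_iff by blast
qed

text \<open>
  The minorant is needed for the upper bound as well: it shows that the infimum defining the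
  extension is taken over a set that is bounded below.
\<close>

lemma ext_expectation_between:
  fixes Y :: "'w \<Rightarrow> real ^ 'd"
  assumes Y: "random_vector H Y" and l: "l \<in> C_l_Lip" and u: "u \<in> C_l_Lip"
    and "\<And>x. l x \<le> f x" "\<And>x. f x \<le> u x"
  shows "E (\<lambda>\<omega>. l (Y \<omega>)) \<le> ext_expectation E f Y" "ext_expectation E f Y \<le> E (\<lambda>\<omega>. u (Y \<omega>))"
proof -
  let ?A = "{E (\<lambda>\<omega>. \<psi> (Y \<omega>)) | \<psi>. \<psi> \<in> C_l_Lip \<and> (\<forall>x. f x \<le> \<psi> x)}"
  have mem: "E (\<lambda>\<omega>. u (Y \<omega>)) \<in> ?A" using u assms(5) by blast
  have lower: "E (\<lambda>\<omega>. l (Y \<omega>)) \<le> r" if "r \<in> ?A" for r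
    using that assms(4) by (auto intro!: mono_C_l_Lip[OF Y l] intro: order_trans)
  show "E (\<lambda>\<omega>. l (Y \<omega>)) \<le> ext_expectation E f Y"
    unfolding ext_expectation_def by (rule cInf_greatest) (use mem lower in auto)
  show "ext_expectation E f Y \<le> E (\<lambda>\<omega>. u (Y \<omega>))"
    unfolding ext_expectation_def by (rule cInf_lower[OF mem]) (use lower in \<open>auto simp: bdd_below_def\<close>)
qed

end

section \<open>Sums of a convolutionary sequence\<close>

locale convolutionary_sequence = sublinear_expectation_space H E
  for H :: "('w \<Rightarrow> real) set" and E +
  fixes X :: "nat \<Rightarrow> 'w \<Rightarrow> real ^ 'd"
  assumes random_vector_X: "i \<ge> 1 \<Longrightarrow> random_vector H (X i)"
    and convolutionary_X: "convolutionary E X"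
    and identically_distributed_X: "i \<ge> 1 \<Longrightarrow> j \<ge> 1 \<Longrightarrow> identically_distributed E (X i) (X j)"
begin

definition S :: "nat \<Rightarrow> 'w \<Rightarrow> real ^ 'd" where
  "S n \<omega> = (\<Sum>i=1..n. X i \<omega>)"

lemma random_vector_S: "random_vector H (S n)"
  unfolding S_def[abs_def] by (rule random_vector_sum) (simp add: random_vector_X)

text \<open>
  The Markov property of the partial sums. It also holds at \<open>n = 0\<close>, where \<open>S 0 = 0\<close> is
  constant, so the inductions below can start at the origin.
\<close>

lemma expectation_S_Suc:
  assumes f: "f \<in> C_l_Lip"
  shows "E (\<lambda>\<omega>. f (S (Suc n) \<omega>)) = E (\<lambda>\<omega>. E (\<lambda>\<omega>'. f (S n \<omega> + X 1 \<omega>')))"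
proof (cases "n = 0")
  case True
  then show ?thesis by (simp add: S_def const)
next
  case False
  have "E (\<lambda>\<omega>. f (S (Suc n) \<omega>)) = E (\<lambda>\<omega>. f (S n \<omega> + X (n + 1) \<omega>))"
    by (simp add: S_def)
  also have "\<dots> = E (\<lambda>\<omega>. E (\<lambda>\<omega>'. f (S n \<omega> + X (n + 1) \<omega>')))"
    using convolutionary_X f False
    unfolding convolutionary_def of_convolution_def S_def by (simp add: Suc_le_eq)
  also have "\<dots> = E (\<lambda>\<omega>. E (\<lambda>\<omega>'. f (S n \<omega> + X 1 \<omega>')))"
  proof -
    have "E (\<lambda>\<omega>'. f (x + X (n + 1) \<omega>')) = E (\<lambda>\<omega>'. f (x + X 1 \<omega>'))" for x
      using identically_distributed_X[of "n + 1" 1] C_l_Lip_translate[OF f, of x]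
      unfolding identically_distributed_def by (auto dest: bspec[where x = "\<lambda>z. f (x + z)"])
    then show ?thesis by presburger
  qed
  finally show ?thesis .
qed

text \<open>
  Up to the drift \<open>c\<close> per step, \<open>f n (S n)\<close> is a supermartingale in the first lemma and a
  submartingale in the second one.
\<close>

lemma expectation_S_le:
  assumes f: "\<And>n. f n \<in> C_l_Lip"
    and step: "\<And>n x. E (\<lambda>\<omega>. f (Suc n) (x + X 1 \<omega>)) \<le> f n x + c"
  shows "E (\<lambda>\<omega>. f n (S n \<omega>)) \<le> f 0 0 + real n * c"
proof (induction n)
  case 0
  then show ?case by (simp add: S_def const)
next
  case (Suc n)
  have "E (\<lambda>\<omega>. f (Suc n) (S (Suc n) \<omega>)) = E (\<lambda>\<omega>. E (\<lambda>\<omega>'. f (Suc n) (S n \<omega> + X 1 \<omega>')))"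
    by (rule expectation_S_Suc[OF f])
  also have "\<dots> \<le> E (\<lambda>\<omega>. c + 1 * f n (S n \<omega>))"
    by (rule mono_C_l_Lip[OF random_vector_S, of "\<lambda>x. E (\<lambda>\<omega>'. f (Suc n) (x + X 1 \<omega>'))"])
      (use step in \<open>auto intro!: C_l_Lip_shifted_expectation random_vector_X f C_l_Lip_intros simp: add.commute\<close>)
  also have "\<dots> = c + E (\<lambda>\<omega>. f n (S n \<omega>))"
    by (subst affine_C_l_Lip[OF random_vector_S f]) auto
  finally show ?case using Suc by (simp add: algebra_simps)
qed

lemma expectation_S_ge:
  assumes f: "\<And>n. f n \<in> C_l_Lip"
    and step: "\<And>n x. f n x - c \<le> E (\<lambda>\<omega>. f (Suc n) (x + X 1 \<omega>))"
  shows "f 0 0 - real n * c \<le> E (\<lambda>\<omega>. f n (S n \<omega>))"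
proof (induction n)
  case 0
  then show ?case by (simp add: S_def const)
next
  case (Suc n)
  have "- c + E (\<lambda>\<omega>. f n (S n \<omega>)) = E (\<lambda>\<omega>. - c + 1 * f n (S n \<omega>))"
    by (subst affine_C_l_Lip[OF random_vector_S f]) auto
  also have "\<dots> \<le> E (\<lambda>\<omega>. E (\<lambda>\<omega>'. f (Suc n) (S n \<omega> + X 1 \<omega>')))"
    by (rule mono_C_l_Lip[OF random_vector_S, of _ "\<lambda>x. E (\<lambda>\<omega>'. f (Suc n) (x + X 1 \<omega>'))"])
      (use step in \<open>auto intro!: C_l_Lip_shifted_expectation random_vector_X f C_l_Lip_intros simp: add.commute\<close>)
  also have "\<dots> = E (\<lambda>\<omega>. f (Suc n) (S (Suc n) \<omega>))"
    by (rule expectation_S_Suc[OF f, symmetric])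
  finally show ?case using Suc by (simp add: algebra_simps)
qed

lemma random_vector_X1: "random_vector H (X 1)" by (simp add: random_vector_X)

text \<open>
  Expanding the square: the cross term \<open>2 \<langle>q, X\<^sub>1 - g\<rangle>\<close> contributes the gap between the support
  function \<open>E[\<langle>q, X\<^sub>1\<rangle>]\<close> and \<open>\<langle>q, g\<rangle>\<close>. For the negative square the sign of \<open>q\<close> changes, since
  \<open>E\<close> is not odd.
\<close>

lemma expectation_norm_sq_le:
  "E (\<lambda>\<omega>. (norm (q + (X 1 \<omega> - g)))\<^sup>2)
    \<le> (norm q)\<^sup>2 + 2 * (E (\<lambda>\<omega>. q \<bullet> X 1 \<omega>) - q \<bullet> g) + E (\<lambda>\<omega>. (norm (X 1 \<omega> - g))\<^sup>2)"
proof -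
  have "E (\<lambda>\<omega>. (norm (q + (X 1 \<omega> - g)))\<^sup>2)
      = E (\<lambda>\<omega>. (((norm q)\<^sup>2 - 2 * (q \<bullet> g)) + 2 * (q \<bullet> X 1 \<omega>)) + (norm (X 1 \<omega> - g))\<^sup>2)"
    by (simp add: power2_norm_eq_inner inner_simps inner_commute algebra_simps)
  also have "\<dots> \<le> E (\<lambda>\<omega>. ((norm q)\<^sup>2 - 2 * (q \<bullet> g)) + 2 * (q \<bullet> X 1 \<omega>)) + E (\<lambda>\<omega>. (norm (X 1 \<omega> - g))\<^sup>2)"
    by (rule subadditive_C_l_Lip[OF random_vector_X1]) (intro C_l_Lip_intros)+
  also have "E (\<lambda>\<omega>. ((norm q)\<^sup>2 - 2 * (q \<bullet> g)) + 2 * (q \<bullet> X 1 \<omega>))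
      = ((norm q)\<^sup>2 - 2 * (q \<bullet> g)) + 2 * E (\<lambda>\<omega>. q \<bullet> X 1 \<omega>)"
    by (rule affine_C_l_Lip[OF random_vector_X1 C_l_Lip_inner]) simp
  finally show ?thesis by (simp add: algebra_simps)
qed

lemma expectation_minus_norm_sq_ge:
  "- (norm q)\<^sup>2 + 2 * (E (\<lambda>\<omega>. (- q) \<bullet> X 1 \<omega>) + q \<bullet> g) - E (\<lambda>\<omega>. (norm (X 1 \<omega> - g))\<^sup>2)
    \<le> E (\<lambda>\<omega>. - (norm (q + (X 1 \<omega> - g)))\<^sup>2)"
proof -
  have q: "(\<lambda>x. - (norm (q + (x - g)))\<^sup>2) \<in> C_l_Lip"
    using C_l_Lip_minus[OF C_l_Lip_norm_minus_power[of "g - q" 2]] by (simp add: algebra_simps)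
  have "(- (norm q)\<^sup>2 + 2 * (q \<bullet> g)) + 2 * E (\<lambda>\<omega>. (- q) \<bullet> X 1 \<omega>)
      = E (\<lambda>\<omega>. (- (norm q)\<^sup>2 + 2 * (q \<bullet> g)) + 2 * ((- q) \<bullet> X 1 \<omega>))"
    by (rule affine_C_l_Lip[OF random_vector_X1 C_l_Lip_inner, symmetric]) simp
  also have "\<dots> = E (\<lambda>\<omega>. - (norm (q + (X 1 \<omega> - g)))\<^sup>2 + (norm (X 1 \<omega> - g))\<^sup>2)"
    by (simp add: power2_norm_eq_inner inner_simps inner_commute algebra_simps)
  also have "\<dots> \<le> E (\<lambda>\<omega>. - (norm (q + (X 1 \<omega> - g)))\<^sup>2) + E (\<lambda>\<omega>. (norm (X 1 \<omega> - g))\<^sup>2)"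
    by (rule subadditive_C_l_Lip[OF random_vector_X1 q]) (intro C_l_Lip_intros)
  finally show ?thesis by (simp add: algebra_simps)
qed

lemma second_moment_bounded:
  assumes "bounded \<Gamma>"
  obtains V where "\<And>g. g \<in> \<Gamma> \<Longrightarrow> E (\<lambda>\<omega>. (norm (X 1 \<omega> - g))\<^sup>2) \<le> V"
proof -
  obtain R where R: "\<And>g. g \<in> \<Gamma> \<Longrightarrow> norm g \<le> R"
    using assms by (auto simp: bounded_iff)
  have "E (\<lambda>\<omega>. (norm (X 1 \<omega> - g))\<^sup>2) \<le> E (\<lambda>\<omega>. (norm (X 1 \<omega>) + R)\<^sup>2)" if "g \<in> \<Gamma>" for g
  proof (rule mono_C_l_Lip[OF random_vector_X1])
    show "(norm (x - g))\<^sup>2 \<le> (norm x + R)\<^sup>2" for x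
      using R[OF that] norm_triangle_ineq4[of x g] by (intro power_mono) auto
  qed (intro C_l_Lip_intros)+
  with that show ?thesis by blast
qed

text \<open>
  The hypothesis \<open>support\<close> says that \<open>E[\<langle>p, X\<^sub>1\<rangle>]\<close> is attained as \<open>\<langle>p, g\<rangle>\<close> on \<open>\<Gamma>\<close>. The maximiser \<open>g\<close>
  depends on the current position \<open>x\<close> only, not on the next increment, and this is what lets the
  cross term cancel.
\<close>

lemma expectation_infdist_sq_le:
  assumes \<Gamma>: "\<Gamma> \<noteq> {}" "closed \<Gamma>" "convex \<Gamma>"
    and support: "\<And>p. \<exists>g\<in>\<Gamma>. E (\<lambda>\<omega>. p \<bullet> X 1 \<omega>) = p \<bullet> g"
    and V: "\<And>g. g \<in> \<Gamma> \<Longrightarrow> E (\<lambda>\<omega>. (norm (X 1 \<omega> - g))\<^sup>2) \<le> V"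
  shows "E (\<lambda>\<omega>. (infdist (S n \<omega>) ((*\<^sub>R) (real n) ` \<Gamma>))\<^sup>2) \<le> real n * V"
proof -
  define f where "f n x = (infdist x ((*\<^sub>R) (real n) ` \<Gamma>))\<^sup>2" for n and x :: "real ^ 'd"
  have "E (\<lambda>\<omega>. f n (S n \<omega>)) \<le> f 0 0 + real n * V"
  proof (rule expectation_S_le)
    show "f n \<in> C_l_Lip" for n unfolding f_def[abs_def] by (intro C_l_Lip_intros)
    show "E (\<lambda>\<omega>. f (Suc n) (x + X 1 \<omega>)) \<le> f n x + V" for n x
    proof -
      obtain a where a: "a \<in> \<Gamma>" "infdist x ((*\<^sub>R) (real n) ` \<Gamma>) = dist x (real n *\<^sub>R a)"
        using infdist_attains_inf[OF closed_scaling[OF \<Gamma>(2)], of "real n" x] \<Gamma>(1) by auto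
      define q where "q = x - real n *\<^sub>R a"
      \<comment> \<open>the point at which the cross term of \<open>expectation_norm_sq_le\<close> vanishes\<close>
      obtain g where g: "g \<in> \<Gamma>" "E (\<lambda>\<omega>. q \<bullet> X 1 \<omega>) = q \<bullet> g"
        using support by blast
      have "real n *\<^sub>R a + g \<in> (*\<^sub>R) (real (Suc n)) ` \<Gamma>"
      proof -
        have "(real n / real (Suc n)) *\<^sub>R a + (1 / real (Suc n)) *\<^sub>R g \<in> \<Gamma>"
          using a(1) g(1) by (intro convexD[OF \<Gamma>(3)]) (auto simp: field_simps)
        moreover have "real n *\<^sub>R a + g = real (Suc n) *\<^sub>R ((real n / real (Suc n)) *\<^sub>R a + (1 / real (Suc n)) *\<^sub>R g)"
          by (simp add: scaleR_add_right del: of_nat_Suc)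
        ultimately show ?thesis by blast
      qed
      then have "f (Suc n) (x + z) \<le> (norm (q + (z - g)))\<^sup>2" for z
        unfolding f_def using infdist_le[of "real n *\<^sub>R a + g" _ "x + z"]
        by (intro power_mono) (auto simp: dist_norm q_def algebra_simps infdist_nonneg)
      moreover have "(\<lambda>z. (norm (q + (z - g)))\<^sup>2) \<in> C_l_Lip"
        using C_l_Lip_norm_minus_power[of "g - q" 2] by (simp add: algebra_simps)
      moreover have "(\<lambda>z. f (Suc n) (x + z)) \<in> C_l_Lip"
        by (rule C_l_Lip_translate) (unfold f_def, intro C_l_Lip_intros)
      ultimately have "E (\<lambda>\<omega>. f (Suc n) (x + X 1 \<omega>)) \<le> E (\<lambda>\<omega>. (norm (q + (X 1 \<omega> - g)))\<^sup>2)"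
        by (intro mono_C_l_Lip[OF random_vector_X1])
      also have "\<dots> \<le> (norm q)\<^sup>2 + V"
        using expectation_norm_sq_le[of q g] g V[OF g(1)] by simp
      also have "(norm q)\<^sup>2 = f n x" by (simp add: f_def a(2) q_def dist_norm)
      finally show ?thesis .
    qed
  qed
  moreover have "f 0 0 = 0" using \<Gamma>(1) by (simp add: f_def image_constant_conv)
  ultimately show ?thesis by (simp add: f_def)
qed

text \<open>
  Here one fixed \<open>g\<close> serves at every step; it only has to lie below the support function, so that
  the cross term can be dropped.
\<close>

lemma expectation_minus_dist_sq_ge:
  assumes support: "\<And>p. p \<bullet> g \<le> E (\<lambda>\<omega>. p \<bullet> X 1 \<omega>)"
    and V: "E (\<lambda>\<omega>. (norm (X 1 \<omega> - g))\<^sup>2) \<le> V"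
  shows "- (real n * V) \<le> E (\<lambda>\<omega>. - (norm (S n \<omega> - real n *\<^sub>R g))\<^sup>2)"
proof -
  define f where "f n x = - (norm (x - real n *\<^sub>R g))\<^sup>2" for n and x :: "real ^ 'd"
  have "f 0 0 - real n * V \<le> E (\<lambda>\<omega>. f n (S n \<omega>))"
  proof (rule expectation_S_ge)
    show "f n \<in> C_l_Lip" for n unfolding f_def[abs_def] by (intro C_l_Lip_intros)
    show "f n x - V \<le> E (\<lambda>\<omega>. f (Suc n) (x + X 1 \<omega>))" for n x
      using expectation_minus_norm_sq_ge[of "x - real n *\<^sub>R g" g] support[of "- (x - real n *\<^sub>R g)"] V
      by (simp add: f_def algebra_simps)
  qed
  then show ?thesis by (simp add: f_def)
qed

end

section \<open>Quadratic bounds for continuous functions of linear growth\<close>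

text \<open>
  Near \<open>\<Gamma>\<close> uniform continuity keeps \<open>\<phi>\<close> below \<open>M + \<epsilon>\<close>. At distance at least \<open>\<delta>\<close> from \<open>\<Gamma>\<close> the
  linear growth of \<open>\<phi>\<close> is absorbed by a large multiple of the squared distance. A singleton \<open>\<Gamma>\<close>
  and \<open>- \<phi>\<close> in place of \<open>\<phi>\<close> give a quadratic minorant touching \<open>\<phi>\<close> up to \<open>\<epsilon>\<close> at a point.
\<close>

lemma quadratic_majorant:
  fixes \<phi> :: "'a::euclidean_space \<Rightarrow> real"
  assumes cont: "continuous_on UNIV \<phi>" and growth: "\<And>x. \<bar>\<phi> x\<bar> \<le> C * (1 + norm x)"
    and \<Gamma>: "\<Gamma> \<noteq> {}" "compact \<Gamma>" and M: "\<And>x. x \<in> \<Gamma> \<Longrightarrow> \<phi> x \<le> M" and "\<epsilon> > 0"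
  obtains K where "K \<ge> 0" "\<And>x. \<phi> x \<le> M + \<epsilon> + K * (infdist x \<Gamma>)\<^sup>2"
proof -
  have C: "C \<ge> 0" using growth[of 0] by simp
  obtain R where R: "\<And>x. x \<in> \<Gamma> \<Longrightarrow> norm x \<le> R"
    using compact_imp_bounded[OF \<Gamma>(2)] by (auto simp: bounded_iff)
  have "R \<ge> 0" using R \<Gamma>(1) norm_ge_zero order_trans by blast
  have proj: "\<exists>g\<in>\<Gamma>. infdist x \<Gamma> = dist x g" for x
    using infdist_attains_inf[OF compact_imp_closed[OF \<Gamma>(2)] \<Gamma>(1)] by metis
  have "uniformly_continuous_on {x. infdist x \<Gamma> \<le> 1} \<phi>"
    by (intro compact_uniformly_continuous continuous_on_subset[OF cont] compact_infdist_le \<Gamma>) auto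
  then obtain d where d: "d > 0"
    "\<And>x y. infdist x \<Gamma> \<le> 1 \<Longrightarrow> infdist y \<Gamma> \<le> 1 \<Longrightarrow> dist y x < d \<Longrightarrow> dist (\<phi> y) (\<phi> x) < \<epsilon>"
    unfolding uniformly_continuous_on_def using \<open>\<epsilon> > 0\<close> by (metis (mono_tags, lifting) mem_Collect_eq)
  define \<delta> where "\<delta> = min d 1"
  have \<delta>: "\<delta> > 0" using d by (simp add: \<delta>_def)
  \<comment> \<open>For \<open>t \<ge> \<delta>\<close> this yields \<open>2 C (1 + R) + C t \<le> K t\<^sup>2\<close>; one \<open>C (1 + R)\<close> bounds \<open>\<phi>\<close> on \<open>\<Gamma>\<close>,
    the other compensates a negative \<open>M\<close>.\<close>
  define K where "K = 2 * C * (1 + R) / \<delta>\<^sup>2 + C / \<delta>"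
  have K: "K \<ge> 0" using C \<open>R \<ge> 0\<close> \<delta> by (simp add: K_def)
  have "\<phi> x \<le> M + \<epsilon> + K * (infdist x \<Gamma>)\<^sup>2" for x
  proof -
    obtain g where g: "g \<in> \<Gamma>" "infdist x \<Gamma> = dist x g" using proj by blast
    let ?d = "infdist x \<Gamma>"
    show ?thesis
    proof (cases "?d < \<delta>")
      case True
      then have "dist (\<phi> x) (\<phi> g) < \<epsilon>" using g by (intro d) (auto simp: \<delta>_def)
      then have "\<phi> x \<le> M + \<epsilon>" using M[OF g(1)] by (simp add: dist_real_def)
      then show ?thesis using K by (simp add: add_increasing2)
    next
      case False
      have "norm x \<le> R + ?d"
        using R[OF g(1)] norm_triangle_ineq[of g "x - g"] g(2) by (simp add: dist_norm)
      then have "C * (1 + norm x) \<le> C * (1 + (R + ?d))" using C by (intro mult_left_mono) auto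
      then have 1: "\<phi> x \<le> C * (1 + R) + C * ?d" using growth[of x] by (simp add: algebra_simps)
      have "C * (1 + norm g) \<le> C * (1 + R)" using C R[OF g(1)] by (intro mult_left_mono) auto
      then have 2: "- (C * (1 + R)) \<le> M" using growth[of g] M[OF g(1)] by linarith
      have r: "1 \<le> ?d / \<delta>" using False \<delta> by (simp add: field_simps)
      then have "1 \<le> (?d / \<delta>)\<^sup>2" by (simp add: one_le_power)
      then have 3: "2 * C * (1 + R) * 1 \<le> 2 * C * (1 + R) * (?d / \<delta>)\<^sup>2"
        using C \<open>R \<ge> 0\<close> by (intro mult_left_mono) auto
      have 4: "C * ?d * 1 \<le> C * ?d * (?d / \<delta>)"
        using C r by (intro mult_left_mono) (auto simp: infdist_nonneg)
      have "K * ?d\<^sup>2 = 2 * C * (1 + R) * (?d / \<delta>)\<^sup>2 + C * ?d * (?d / \<delta>)"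
        by (simp add: K_def power_divide add_divide_distrib algebra_simps power2_eq_square)
      with 1 2 3 4 \<open>\<epsilon> > 0\<close> show ?thesis by linarith
    qed
  qed
  with K that show ?thesis by blast
qed

section \<open>The law of large numbers\<close>

theorem theorem8:
  fixes H :: "('w \<Rightarrow> real) set"
    and E :: "('w \<Rightarrow> real) \<Rightarrow> real"
    and X :: "nat \<Rightarrow> 'w \<Rightarrow> real ^ 'd"
    and \<eta> :: "'w \<Rightarrow> real ^ 'd"
    and \<phi> :: "real ^ 'd \<Rightarrow> real"
  assumes "sublinear_expectation_space H E"
    and "\<And>i. i \<ge> 1 \<Longrightarrow> random_vector H (X i)"
    and "convolutionary E X"
    and "\<And>i j. i \<ge> 1 \<Longrightarrow> j \<ge> 1 \<Longrightarrow> identically_distributed E (X i) (X j)"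
    and "ereal (E (\<lambda>\<omega>. (norm (X 1 \<omega>))\<^sup>2)) < \<infinity>"
    and "random_vector H \<eta>"
    and "maximal_distributed E \<eta>"
    and "\<And>p. E (\<lambda>\<omega>. p \<bullet> \<eta> \<omega>) = E (\<lambda>\<omega>. p \<bullet> X 1 \<omega>)"
    and "continuous_on UNIV \<phi>"
    and "\<exists>C>0. \<forall>x. \<bar>\<phi> x\<bar> \<le> C * (1 + norm x)"
  shows "(\<lambda>n. ext_expectation E \<phi> (\<lambda>\<omega>. (1 / real n) *\<^sub>R (\<Sum>i=1..n. X i \<omega>)))
           \<longlonglongrightarrow> ext_expectation E \<phi> \<eta>"
proof -
  interpret convolutionary_sequence H E X
    using assms(1-4) unfolding convolutionary_sequence_def convolutionary_sequence_axioms_def by blast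
  obtain \<Gamma> where \<Gamma>: "\<Gamma> \<noteq> {}" "bounded \<Gamma>" "closed \<Gamma>" "convex \<Gamma>"
    and attained: "\<And>f. f \<in> C_l_Lip \<Longrightarrow> E (\<lambda>\<omega>. f (\<eta> \<omega>)) \<in> f ` \<Gamma>"
    and upper: "\<And>f x. f \<in> C_l_Lip \<Longrightarrow> x \<in> \<Gamma> \<Longrightarrow> f x \<le> E (\<lambda>\<omega>. f (\<eta> \<omega>))"
    using assms(7) unfolding maximal_distributed_def by blast
  have "compact \<Gamma>" using \<Gamma> by (simp add: compact_eq_bounded_closed)
  obtain C where growth: "\<And>x. \<bar>\<phi> x\<bar> \<le> C * (1 + norm x)" using assms(10) by blast
  obtain g where g: "g \<in> \<Gamma>" "\<And>x. x \<in> \<Gamma> \<Longrightarrow> \<phi> x \<le> \<phi> g"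
    using continuous_attains_sup[OF \<open>compact \<Gamma>\<close> \<Gamma>(1) continuous_on_subset[OF assms(9)]] by auto
  obtain V where V: "\<And>g. g \<in> \<Gamma> \<Longrightarrow> E (\<lambda>\<omega>. (norm (X 1 \<omega> - g))\<^sup>2) \<le> V"
    using second_moment_bounded[OF \<Gamma>(2)] by blast
  have support: "\<exists>x\<in>\<Gamma>. E (\<lambda>\<omega>. p \<bullet> X 1 \<omega>) = p \<bullet> x" for p
    using attained[OF C_l_Lip_inner, of p] assms(8)[of p] by auto
  have support_le: "p \<bullet> g \<le> E (\<lambda>\<omega>. p \<bullet> X 1 \<omega>)" for p
    using upper[OF C_l_Lip_inner g(1), of p] assms(8)[of p] by simp
  show ?thesis
  proof (rule LIMSEQ_I)
    fix r :: real assume "r > 0"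
    \<comment> \<open>The error \<open>\<epsilon>\<close> is made twice at \<open>\<phi>\<close> (for the means and for \<open>\<eta>\<close>) and once by the
      \<open>O(1/n)\<close> term.\<close>
    define \<epsilon> where "\<epsilon> = r / 4"
    have \<epsilon>: "\<epsilon> > 0" using \<open>r > 0\<close> by (simp add: \<epsilon>_def)
    obtain K where K: "K \<ge> 0" "\<And>x. \<phi> x \<le> \<phi> g + \<epsilon> + K * (infdist x \<Gamma>)\<^sup>2"
      using quadratic_majorant[OF assms(9) growth \<Gamma>(1) \<open>compact \<Gamma>\<close> g(2) \<epsilon>] by blast
    have "continuous_on UNIV (\<lambda>x. - \<phi> x)" using assms(9) by (rule continuous_on_minus)
    then obtain L where L: "L \<ge> 0" "\<And>x. - \<phi> x \<le> - \<phi> g + \<epsilon> + L * (infdist x {g})\<^sup>2"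
      using quadratic_majorant[of "\<lambda>x. - \<phi> x" C "{g}" "- \<phi> g" \<epsilon>] growth \<epsilon> by auto
    define u where "u x = (\<phi> g + \<epsilon>) + K * (infdist x \<Gamma>)\<^sup>2" for x
    define l where "l x = (\<phi> g - \<epsilon>) + L * (- (norm (x - g))\<^sup>2)" for x
    have ul: "u \<in> C_l_Lip" "l \<in> C_l_Lip"
      unfolding u_def[abs_def] l_def[abs_def] by (intro C_l_Lip_intros)+
    have le: "l x \<le> \<phi> x" "\<phi> x \<le> u x" for x
      using K(2)[of x] L(2)[of x] by (simp_all add: u_def l_def dist_norm)
    have eta: "\<phi> g - \<epsilon> \<le> ext_expectation E \<phi> \<eta>" "ext_expectation E \<phi> \<eta> \<le> \<phi> g + \<epsilon>"
    proof -
      have "l g \<le> E (\<lambda>\<omega>. l (\<eta> \<omega>))" by (rule upper[OF ul(2) g(1)])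
      then show "\<phi> g - \<epsilon> \<le> ext_expectation E \<phi> \<eta>"
        using ext_expectation_between(1)[OF assms(6) ul(2,1), of \<phi>] le by (simp add: l_def)
      obtain x where "x \<in> \<Gamma>" "E (\<lambda>\<omega>. u (\<eta> \<omega>)) = u x" using attained[OF ul(1)] by auto
      then show "ext_expectation E \<phi> \<eta> \<le> \<phi> g + \<epsilon>"
        using ext_expectation_between(2)[OF assms(6) ul(2,1), of \<phi>] le by (simp add: u_def)
    qed
    have mean: "\<phi> g - \<epsilon> - L * V / real n \<le> ext_expectation E \<phi> (\<lambda>\<omega>. (1 / real n) *\<^sub>R S n \<omega>)"
      "ext_expectation E \<phi> (\<lambda>\<omega>. (1 / real n) *\<^sub>R S n \<omega>) \<le> \<phi> g + \<epsilon> + K * V / real n"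
      if n: "n > 0" for n
    proof -
      note between = ext_expectation_between[OF random_vector_scaleR[OF random_vector_S[of n], of "1 / real n"] ul(2,1) le]
      have "l ((1 / real n) *\<^sub>R x) = (\<phi> g - \<epsilon>) + (L / (real n)\<^sup>2) * (- (norm (x - real n *\<^sub>R g))\<^sup>2)" for x
      proof -
        have "(1 / real n) *\<^sub>R x - g = (1 / real n) *\<^sub>R (x - real n *\<^sub>R g)"
          using n by (simp add: algebra_simps)
        then have "norm ((1 / real n) *\<^sub>R x - g) = norm (x - real n *\<^sub>R g) / real n" by simp
        then show ?thesis by (simp add: l_def power_divide)
      qed
      then have "E (\<lambda>\<omega>. l ((1 / real n) *\<^sub>R S n \<omega>))
          = (\<phi> g - \<epsilon>) + (L / (real n)\<^sup>2) * E (\<lambda>\<omega>. - (norm (S n \<omega> - real n *\<^sub>R g))\<^sup>2)"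
        using L(1)
        by (simp only:) (intro affine_C_l_Lip[OF random_vector_S C_l_Lip_minus[OF C_l_Lip_norm_minus_power]], simp)
      moreover have "(L / (real n)\<^sup>2) * (- (real n * V)) \<le> (L / (real n)\<^sup>2) * E (\<lambda>\<omega>. - (norm (S n \<omega> - real n *\<^sub>R g))\<^sup>2)"
        using expectation_minus_dist_sq_ge[OF support_le V[OF g(1)], of n] L(1)
        by (intro mult_left_mono) auto
      moreover have "(L / (real n)\<^sup>2) * (- (real n * V)) = - (L * V / real n)"
        using n by (simp add: field_simps power2_eq_square)
      ultimately show "\<phi> g - \<epsilon> - L * V / real n \<le> ext_expectation E \<phi> (\<lambda>\<omega>. (1 / real n) *\<^sub>R S n \<omega>)"
        using between(1) by linarith
      let ?D = "\<lambda>x. (infdist x ((*\<^sub>R) (real n) ` \<Gamma>))\<^sup>2"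
      have D: "?D \<in> C_l_Lip" by (intro C_l_Lip_intros)
      have "u ((1 / real n) *\<^sub>R x) \<le> (\<phi> g + \<epsilon>) + (K / (real n)\<^sup>2) * ?D x" for x
      proof -
        obtain a where a: "a \<in> \<Gamma>" "infdist x ((*\<^sub>R) (real n) ` \<Gamma>) = dist x (real n *\<^sub>R a)"
          using infdist_attains_inf[OF closed_scaling[OF \<Gamma>(3)], of "real n" x] \<Gamma>(1) by auto
        have "(1 / real n) *\<^sub>R x - a = (1 / real n) *\<^sub>R (x - real n *\<^sub>R a)"
          using n by (simp add: algebra_simps)
        then have "dist ((1 / real n) *\<^sub>R x) a = dist x (real n *\<^sub>R a) / real n"
          by (simp add: dist_norm)
        then have "infdist ((1 / real n) *\<^sub>R x) \<Gamma> \<le> infdist x ((*\<^sub>R) (real n) ` \<Gamma>) / real n"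
          using infdist_le[OF a(1)] a(2) by metis
        then have "(infdist ((1 / real n) *\<^sub>R x) \<Gamma>)\<^sup>2 \<le> ?D x / (real n)\<^sup>2"
          by (metis infdist_nonneg power_divide power_mono)
        then have "K * (infdist ((1 / real n) *\<^sub>R x) \<Gamma>)\<^sup>2 \<le> K * (?D x / (real n)\<^sup>2)"
          using K(1) by (rule mult_left_mono)
        then show ?thesis by (simp add: u_def)
      qed
      then have "E (\<lambda>\<omega>. u ((1 / real n) *\<^sub>R S n \<omega>)) \<le> E (\<lambda>\<omega>. (\<phi> g + \<epsilon>) + (K / (real n)\<^sup>2) * ?D (S n \<omega>))"
        by (intro mono_C_l_Lip[OF random_vector_S] C_l_Lip_scale[OF ul(1)] C_l_Lip_intros)
      moreover have "\<dots> = (\<phi> g + \<epsilon>) + (K / (real n)\<^sup>2) * E (\<lambda>\<omega>. ?D (S n \<omega>))"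
        using K(1) by (intro affine_C_l_Lip[OF random_vector_S D]) auto
      moreover have "(K / (real n)\<^sup>2) * E (\<lambda>\<omega>. ?D (S n \<omega>)) \<le> (K / (real n)\<^sup>2) * (real n * V)"
        using expectation_infdist_sq_le[OF \<Gamma>(1,3,4) support V, of n] K(1)
        by (intro mult_left_mono) auto
      moreover have "(K / (real n)\<^sup>2) * (real n * V) = K * V / real n"
        using n by (simp add: field_simps power2_eq_square)
      ultimately show "ext_expectation E \<phi> (\<lambda>\<omega>. (1 / real n) *\<^sub>R S n \<omega>) \<le> \<phi> g + \<epsilon> + K * V / real n"
        using between(2) by linarith
    qed
    have "(\<lambda>n. K * V / real n) \<longlonglongrightarrow> 0" "(\<lambda>n. L * V / real n) \<longlonglongrightarrow> 0"
      by (rule lim_const_over_n)+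
    then have "\<forall>\<^sub>F n in sequentially. K * V / real n < \<epsilon> \<and> L * V / real n < \<epsilon>"
      using \<epsilon> by (intro eventually_conj order_tendstoD(2))
    then have "\<forall>\<^sub>F n in sequentially. norm (ext_expectation E \<phi> (\<lambda>\<omega>. (1 / real n) *\<^sub>R S n \<omega>)
        - ext_expectation E \<phi> \<eta>) < r"
      using eventually_gt_at_top[of 0]
    proof eventually_elim
      case (elim n)
      have "r = 4 * \<epsilon>" by (simp add: \<epsilon>_def)
      with elim mean[OF elim(2)] eta \<epsilon> show ?case unfolding real_norm_def by linarith
    qed
    then show "\<exists>no. \<forall>n\<ge>no. norm (ext_expectation E \<phi> (\<lambda>\<omega>. (1 / real n) *\<^sub>R (\<Sum>i=1..n. X i \<omega>))
        - ext_expectation E \<phi> \<eta>) < r"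
      by (simp add: eventually_sequentially S_def)
  qed
qed

end
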